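(* Let $x_1>y_1>0$ and $x_3>y_3>0$ be real numbers, let $a_1=\frac{x_1-y_1}{x_1+y_1}$, let $\alpha>0$ be the real number with $\cosh\alpha=\frac{x_3}{y_3}$, and let $m=\sqrt{a_1\cosh\alpha}$. Consider the point $(x,y)=(a_1\cosh\alpha,\;a_1m)$ on the curve $y^2=x^3-n^2x$ with $n=a_1\sinh\alpha$. If $\sinh^2\alpha$ and $\cosh^2\alpha$ are integers, then the right triangle constructed from this point, with sides $$\frac{x^2-n^2}{y}=\frac{a_1}{m},\qquad \frac{2nx}{y}=\frac{2a_1\sinh\alpha\cosh\alpha}{m},\qquad \frac{x^2+n^2}{y}=\frac{a_1(\sinh^2\alpha+\cosh^2\alpha)}{m},$$ which after division by $a_1/m$ become $1$, $2\sinh\alpha\cosh\alpha$, $\sinh^2\alpha+\cosh^2\alpha$, does not have all sides integer or rational, neither before nor after this division.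
   Context: From a point $(x,y)$ with $y\neq0$ on a curve $y^2=x^3-n^2x$ one constructs the right triangle with sides $(x^2-n^2)/y$, $2nx/y$, $(x^2+n^2)/y$. In the setting of a cuboid with edges $a,b,d$ and face diagonals $c,e,f$ given by $a^2+b^2=c^2$, $a^2+d^2=e^2$, $b^2+d^2=f^2$, the pairs $(x_1,y_1)$ and $(x_3,y_3)$ are those with $a=2x_1y_1$, $b=x_1^2-y_1^2$ and $b=2x_3y_3$, $d=x_3^2-y_3^2$. *)

theory Defs imports Complex_Main begin

definition congruent_curve :: "real \<Rightarrow> (real \<times> real) set" where
  "congruent_curve n = {(x, y). y^2 = x^3 - n^2 * x}"

(* Triangles are given by their side lengths (leg, leg, hypotenuse). *)
type_synonym triangle = "real \<times> real \<times> real"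

definition right_triangle :: "triangle \<Rightarrow> bool" where
  "right_triangle = (\<lambda>(p, q, r). p > 0 \<and> q > 0 \<and> r > 0 \<and> p^2 + q^2 = r^2)"

(* Only meaningful for points with nonzero second coordinate. *)
definition triangle_of_point :: "real \<Rightarrow> real \<times> real \<Rightarrow> triangle" where
  "triangle_of_point n = (\<lambda>(x, y). ((x^2 - n^2) / y, 2 * n * x / y, (x^2 + n^2) / y))"

definition divide_sides :: "triangle \<Rightarrow> real \<Rightarrow> triangle" where
  "divide_sides = (\<lambda>(p, q, r) t. (p / t, q / t, r / t))"

definition all_sides_in :: "triangle \<Rightarrow> real set \<Rightarrow> bool" where
  "all_sides_in = (\<lambda>(p, q, r) S. p \<in> S \<and> q \<in> S \<and> r \<in> S)"

end

theory Submission imports Defs begin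

text \<open>With \<open>k = sinh\<^sup>2 \<alpha>\<close> a positive integer, the square of \<open>2 sinh \<alpha> cosh \<alpha>\<close> is \<open>4k(k + 1)\<close>,
  which lies strictly between \<open>(2k)\<^sup>2\<close> and \<open>(2k + 1)\<^sup>2\<close>, so this leg of the divided triangle is
  irrational. It is also the quotient of the legs of the original triangle, which therefore cannot
  both be rational.\<close>

lemma square_ne_four_mult_consecutive:
  fixes k t :: int
  assumes "k > 0"
  shows "t^2 \<noteq> 4 * k * (k + 1)"
proof
  assume t: "t^2 = 4 * k * (k + 1)"
  \<comment> \<open>Since \<open>t\<close> may be negative, the bounds are put on its absolute
    value; the upper one holds because \<open>4 * k * (k + 1) = (2 * k + 1)^2 - 1\<close>.\<close>
  have "(2 * k)^2 < \<bar>t\<bar>^2" "\<bar>t\<bar>^2 < (2 * k + 1)^2"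
    using t assms by (simp_all add: power2_eq_square algebra_simps)
  then have "2 * k < \<bar>t\<bar>" "\<bar>t\<bar> < 2 * k + 1"
    using assms power_less_imp_less_base[of "2 * k" 2 "\<bar>t\<bar>"]
      power_less_imp_less_base[of "\<bar>t\<bar>" 2 "2 * k + 1"] by linarith+
  then show False by linarith
qed

text \<open>Clearing denominators gives \<open>a^2 = N * b^2\<close>, and divisibility between
  squares passes to their bases, so the denominator divides the numerator.\<close>

lemma Rats_square_Ints_imp_Ints:
  fixes q :: real
  assumes "q \<in> \<rat>" "q^2 \<in> \<int>"
  shows "q \<in> \<int>"
proof -
  obtain a b :: int where b: "b \<noteq> 0" and q: "q = of_int a / of_int b"
    using assms(1) by (metis Rats_cases' less_irrefl)
  obtain N :: int where "q^2 = of_int N"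
    using assms(2) by (auto elim: Ints_cases)
  then have "real_of_int (a^2) = of_int (N * b^2)"
    using b q by (simp add: power_divide field_simps)
  then have "a^2 = N * b^2"
    by (simp only: of_int_eq_iff)
  then have "b dvd a"
    by (metis dvd_triv_right pow_divides_pow_iff zero_less_numeral)
  then show ?thesis
    using b q by auto
qed

text \<open>A rational value would be an integer, because its square is one. Positivity of
  \<open>\<alpha>\<close> excludes \<open>k = 0\<close>, where the product vanishes.\<close>

lemma two_sinh_cosh_irrational:
  fixes \<alpha> :: real
  assumes "\<alpha> > 0" "(sinh \<alpha>)^2 \<in> \<int>"
  shows "2 * sinh \<alpha> * cosh \<alpha> \<notin> \<rat>"
proof
  let ?q = "2 * sinh \<alpha> * cosh \<alpha>"
  assume "?q \<in> \<rat>"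
  obtain k :: int where k: "(sinh \<alpha>)^2 = of_int k"
    using assms(2) by (auto elim: Ints_cases)
  have "(sinh \<alpha>)^2 > 0"
    using assms(1) by simp
  then have "k > 0"
    using k by simp
  have q2: "?q^2 = of_int (4 * k * (k + 1))"
    using k by (simp add: power_mult_distrib cosh_square_eq)
  have "?q \<in> \<int>"
    using \<open>?q \<in> \<rat>\<close> by (rule Rats_square_Ints_imp_Ints) (subst q2, rule Ints_of_int)
  then obtain t :: int where "?q = of_int t"
    by (auto elim: Ints_cases)
  then have "real_of_int (t^2) = of_int (4 * k * (k + 1))"
    using q2 by simp
  then have "t^2 = 4 * k * (k + 1)"
    by (simp only: of_int_eq_iff)
  then show False
    using square_ne_four_mult_consecutive \<open>k > 0\<close> by blast
qed

theorem proposition4: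
  fixes x1 y1 x3 y3 a1 \<alpha> m n x y :: real
    and T T' :: triangle
  assumes "x1 > y1" and "y1 > 0"
    and "x3 > y3" and "y3 > 0"
    and "a1 = (x1 - y1) / (x1 + y1)"
    and "\<alpha> > 0" and "cosh \<alpha> = x3 / y3"
    and "m = sqrt (a1 * cosh \<alpha>)"
    and "n = a1 * sinh \<alpha>"
    and "x = a1 * cosh \<alpha>" and "y = a1 * m"
    and "T = triangle_of_point n (x, y)"
    and "T' = divide_sides T (a1 / m)"
  shows "(x, y) \<in> congruent_curve n \<and> y \<noteq> 0
    \<and> right_triangle T
    \<and> T = (a1 / m, 2 * a1 * sinh \<alpha> * cosh \<alpha> / m, a1 * ((sinh \<alpha>)^2 + (cosh \<alpha>)^2) / m)
    \<and> T' = (1, 2 * sinh \<alpha> * cosh \<alpha>, (sinh \<alpha>)^2 + (cosh \<alpha>)^2)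
    \<and> ((sinh \<alpha>)^2 \<in> \<int> \<and> (cosh \<alpha>)^2 \<in> \<int> \<longrightarrow>
        \<not> (all_sides_in T \<int> \<or> all_sides_in T \<rat>)
        \<and> \<not> (all_sides_in T' \<int> \<or> all_sides_in T' \<rat>))"
proof -
  let ?s = "sinh \<alpha>" and ?c = "cosh \<alpha>"
  have a1: "a1 > 0" using assms by simp
  have s: "?s > 0" using assms by simp
  have c: "?c > 0" by simp
  have m: "m > 0" using assms a1 c by simp
  have m2: "m^2 = a1 * ?c" using assms(8) a1 c by simp
  have y: "y > 0" using assms(11) a1 m by simp
  have c2: "?c^2 = ?s^2 + 1" by (simp add: cosh_square_eq)
  \<comment> \<open>The first identity is \<open>cosh^2 - sinh^2 = 1\<close> scaled by
    \<open>a1^2\<close>; it yields both the curve equation, as \<open>x * (x^2 - n^2)\<close>, and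
    the leg \<open>a1 / m\<close>.\<close>
  have xn: "x^2 - n^2 = a1^2" "x^2 + n^2 = a1^2 * (?s^2 + ?c^2)"
    using assms(9,10) c2 by (simp_all add: power_mult_distrib algebra_simps)
  have "y^2 = a1^2 * x"
    using assms(10,11) m2 by (simp add: power_mult_distrib)
  also have "\<dots> = x^3 - n^2 * x"
    unfolding xn(1)[symmetric] by (simp add: power2_eq_square power3_eq_cube algebra_simps)
  finally have curve: "(x, y) \<in> congruent_curve n"
    by (simp add: congruent_curve_def)
  have T: "T = (a1 / m, 2 * a1 * ?s * ?c / m, a1 * (?s^2 + ?c^2) / m)"
    using assms(9-12) a1 m xn by (simp add: triangle_of_point_def power2_eq_square)
  have T': "T' = (1, 2 * ?s * ?c, ?s^2 + ?c^2)"
    using assms(13) T a1 m by (simp add: divide_sides_def)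
  \<comment> \<open>Pythagoras is checked on the divided triangle, where it reads
    \<open>1 + 4 * s^2 * (s^2 + 1) = (2 * s^2 + 1)^2\<close> with \<open>s = sinh \<alpha>\<close>,
    and then scaled by \<open>a1 / m\<close>.\<close>
  have "1^2 + (2 * ?s * ?c)^2 = (?s^2 + ?c^2)^2"
    unfolding power_mult_distrib c2 by (simp add: power2_eq_square algebra_simps)
  then have "(a1 / m * 1)^2 + (a1 / m * (2 * ?s * ?c))^2 = (a1 / m * (?s^2 + ?c^2))^2"
    unfolding power_mult_distrib[of "a1 / m"] by (simp only: distrib_left[symmetric])
  then have "(a1 / m)^2 + (2 * a1 * ?s * ?c / m)^2 = (a1 * (?s^2 + ?c^2) / m)^2"
    by (simp add: mult_ac)
  then have right: "right_triangle T"
    using T a1 m s c by (simp add: right_triangle_def add_pos_pos)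
  have irr: "\<not> all_sides_in T \<rat>" "\<not> all_sides_in T' \<rat>" if "?s^2 \<in> \<int>"
  proof -
    have notin: "2 * ?s * ?c \<notin> \<rat>"
      using two_sinh_cosh_irrational assms(6) that by blast
    then show "\<not> all_sides_in T' \<rat>"
      by (simp add: T' all_sides_in_def)
    have "2 * ?s * ?c = (2 * a1 * ?s * ?c / m) / (a1 / m)"
      using a1 m by simp
    then show "\<not> all_sides_in T \<rat>"
      using notin Rats_divide[of "2 * a1 * ?s * ?c / m" "a1 / m"]
      unfolding T all_sides_in_def by auto
  qed
  \<comment> \<open>This reduces the integer claims to the rational ones.\<close>
  have "all_sides_in U \<int> \<Longrightarrow> all_sides_in U \<rat>" for U
    using Ints_subset_Rats by (auto simp: all_sides_in_def)
  then show ?thesis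
    using curve y right T T' irr by blast
qed

end
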